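(* Let $R$ be a commutative ring with identity, let $M$ be a coreduced faithful finitely generated comultiplication $R$-module, and let $N$ be a $dqz^\circ$-submodule of $M$. Then for each submodule $K$ of $M$ with $(K:_RN)\neq R$, $(K:_RN)$ is a $z^\circ$-ideal of $R$. In particular, if $\mathfrak{S}_M=M$, then for each submodule $K$ of $M$ with $(K:_RM)\neq R$, $(K:_RM)$ is a $z^\circ$-ideal of $R$.
   Context: For submodules $K,N$ of $M$, an ideal $I$ of $R$ and $r\in R$: $(K:_RN)=\{s\in R: sN\subseteq K\}$, $(K:_Mr)=\{m\in M: rm\in K\}$, $(0:_MI)=\{m\in M: Im=0\}$, $(0:_Mr)=\{m\in M: rm=0\}$. $M$ is a comultiplication module if every submodule $N$ of $M$ has the form $N=(0:_MI)$ for some ideal $I$ of $R$. A proper submodule $L$ of $M$ is completely irreducible if $L=\bigcap_{i\in I}N_i$ for a family of submodules $N_i$ of $M$ implies $L=N_i$ for some $i$. $M$ is coreduced if for every $r\in R$ and every completely irreducible submodule $L$ of $M$, $(L:_Mr)=M$ implies $L+(0:_Mr)=M$. A non-zero submodule $S$ of $M$ is second if for each $a\in R$ multiplication by $a$ on $S$ is either surjective or zero. A maximal second submodule of $M$ is a second submodule of $M$ that is maximal under inclusion among the second submodules of $M$. For a submodule $K$ of $M$, $\mathfrak{S}_K$ is the sum of all maximal second submodules of $M$ contained in $K$ (and $0$ if there are none). A non-zero submodule $N$ of $M$ is a $dqz^\circ$-submodule of $M$ if $N\subseteq\mathfrak{S}_{(0:_Ma)}$ for all $a\in Ann_R(N)$.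 For $a\in R$, $\mathfrak{P}_a$ is the intersection of all minimal prime ideals of $R$ containing $a$ ($\mathfrak{P}_a=R$ if there are none). A proper ideal $I$ of $R$ is a $z^\circ$-ideal if $\mathfrak{P}_a\subseteq I$ for each $a\in I$. *)

theory Defs
  imports "HOL-Algebra.Module" "HOL-Algebra.Ideal"
begin

section \<open>Residuals and annihilators\<close>

text \<open>\<open>colon_ring R M K N\<close> is $(K :_R N)$ and \<open>colon_module M K r\<close> is $(K :_M r)$; the
  corresponding objects with $0$ in place of $K$ are obtained by taking \<open>K = {\<zero>\<^bsub>M\<^esub>}\<close>.\<close>

definition colon_ring ::
    "('a, 'r) ring_scheme \<Rightarrow> ('a, 'b, 'm) module_scheme \<Rightarrow> 'b set \<Rightarrow> 'b set \<Rightarrow> 'a set" where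
  "colon_ring R M K N = {s \<in> carrier R. \<forall>x \<in> N. s \<odot>\<^bsub>M\<^esub> x \<in> K}"

definition colon_module :: "('a, 'b, 'm) module_scheme \<Rightarrow> 'b set \<Rightarrow> 'a \<Rightarrow> 'b set" where
  "colon_module M K r = {x \<in> carrier M. r \<odot>\<^bsub>M\<^esub> x \<in> K}"

definition ann_ring ::
    "('a, 'r) ring_scheme \<Rightarrow> ('a, 'b, 'm) module_scheme \<Rightarrow> 'b set \<Rightarrow> 'a set" where
  "ann_ring R M N = colon_ring R M {\<zero>\<^bsub>M\<^esub>} N"

text \<open>$(0 :_M I)$ for a set \<open>I\<close> of scalars.\<close>

definition ann_module :: "('a, 'b, 'm) module_scheme \<Rightarrow> 'a set \<Rightarrow> 'b set" where
  "ann_module M I = {x \<in> carrier M. \<forall>a \<in> I. a \<odot>\<^bsub>M\<^esub> x = \<zero>\<^bsub>M\<^esub>}"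


section \<open>Classes of modules\<close>

definition faithful_module ::
    "('a, 'r) ring_scheme \<Rightarrow> ('a, 'b, 'm) module_scheme \<Rightarrow> bool" where
  "faithful_module R M \<longleftrightarrow> ann_ring R M (carrier M) = {\<zero>\<^bsub>R\<^esub>}"

definition finitely_generated_module ::
    "('a, 'r) ring_scheme \<Rightarrow> ('a, 'b, 'm) module_scheme \<Rightarrow> bool" where
  "finitely_generated_module R M \<longleftrightarrow>
     (\<exists>X. finite X \<and> X \<subseteq> carrier M \<and>
       carrier M = {(\<Oplus>\<^bsub>M\<^esub>x \<in> X. c x \<odot>\<^bsub>M\<^esub> x) | c. c \<in> X \<rightarrow> carrier R})"

definition comultiplication_module ::
    "('a, 'r) ring_scheme \<Rightarrow> ('a, 'b, 'm) module_scheme \<Rightarrow> bool" where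
  "comultiplication_module R M \<longleftrightarrow>
     (\<forall>N. submodule N R M \<longrightarrow> (\<exists>I. ideal I R \<and> N = ann_module M I))"

text \<open>A family of submodules is represented by the set of its members. Intersecting with
  \<open>carrier M\<close> makes the intersection of the empty family the whole module.\<close>

definition completely_irreducible ::
    "('a, 'r) ring_scheme \<Rightarrow> ('a, 'b, 'm) module_scheme \<Rightarrow> 'b set \<Rightarrow> bool" where
  "completely_irreducible R M L \<longleftrightarrow>
     submodule L R M \<and> L \<noteq> carrier M \<and>
     (\<forall>F. (\<forall>N \<in> F. submodule N R M) \<and> L = carrier M \<inter> \<Inter>F \<longrightarrow> L \<in> F)"

definition coreduced_module ::
    "('a, 'r) ring_scheme \<Rightarrow> ('a, 'b, 'm) module_scheme \<Rightarrow> bool" where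
  "coreduced_module R M \<longleftrightarrow>
     (\<forall>r \<in> carrier R. \<forall>L. completely_irreducible R M L \<longrightarrow>
        colon_module M L r = carrier M \<longrightarrow>
        L <+>\<^bsub>M\<^esub> colon_module M {\<zero>\<^bsub>M\<^esub>} r = carrier M)"


section \<open>Second submodules\<close>

definition second_submodule ::
    "('a, 'r) ring_scheme \<Rightarrow> ('a, 'b, 'm) module_scheme \<Rightarrow> 'b set \<Rightarrow> bool" where
  "second_submodule R M S \<longleftrightarrow>
     submodule S R M \<and> S \<noteq> {\<zero>\<^bsub>M\<^esub>} \<and>
     (\<forall>a \<in> carrier R. (\<lambda>x. a \<odot>\<^bsub>M\<^esub> x) ` S = S \<or> (\<forall>x \<in> S. a \<odot>\<^bsub>M\<^esub> x = \<zero>\<^bsub>M\<^esub>))"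

definition maximal_second_submodule ::
    "('a, 'r) ring_scheme \<Rightarrow> ('a, 'b, 'm) module_scheme \<Rightarrow> 'b set \<Rightarrow> bool" where
  "maximal_second_submodule R M S \<longleftrightarrow>
     second_submodule R M S \<and> (\<forall>T. second_submodule R M T \<and> S \<subseteq> T \<longrightarrow> T = S)"

text \<open>The sum of a possibly infinite set \<open>F\<close> of submodules: all finite sums of elements taken
  from distinct members of \<open>F\<close>. For \<open>F = {}\<close> only the empty sum remains.\<close>

definition submodule_sum :: "('a, 'b, 'm) module_scheme \<Rightarrow> 'b set set \<Rightarrow> 'b set" where
  "submodule_sum M F =
     {(\<Oplus>\<^bsub>M\<^esub>S \<in> A. f S) | A f. finite A \<and> A \<subseteq> F \<and> (\<forall>S \<in> A. f S \<in> S)}"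

text \<open>$\mathfrak{S}_K$\<close>

definition max_second_sum ::
    "('a, 'r) ring_scheme \<Rightarrow> ('a, 'b, 'm) module_scheme \<Rightarrow> 'b set \<Rightarrow> 'b set" where
  "max_second_sum R M K = submodule_sum M {S. maximal_second_submodule R M S \<and> S \<subseteq> K}"

text \<open>$dqz^\circ$-submodules\<close>

definition dqz0_submodule ::
    "('a, 'r) ring_scheme \<Rightarrow> ('a, 'b, 'm) module_scheme \<Rightarrow> 'b set \<Rightarrow> bool" where
  "dqz0_submodule R M N \<longleftrightarrow>
     submodule N R M \<and> N \<noteq> {\<zero>\<^bsub>M\<^esub>} \<and>
     (\<forall>a \<in> ann_ring R M N. N \<subseteq> max_second_sum R M (colon_module M {\<zero>\<^bsub>M\<^esub>} a))"


section \<open>$z^\circ$-ideals\<close>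

definition minimal_prime :: "('a, 'r) ring_scheme \<Rightarrow> 'a set \<Rightarrow> bool" where
  "minimal_prime R P \<longleftrightarrow> primeideal P R \<and> (\<forall>Q. primeideal Q R \<and> Q \<subseteq> P \<longrightarrow> Q = P)"

text \<open>$\mathfrak{P}_a$: the intersection runs over the minimal primes of \<open>R\<close> that contain \<open>a\<close>,
  not over the primes minimal over \<open>a\<close>; it is \<open>carrier R\<close> if there are none.\<close>

definition min_prime_inter :: "('a, 'r) ring_scheme \<Rightarrow> 'a \<Rightarrow> 'a set" where
  "min_prime_inter R a = carrier R \<inter> \<Inter>{P. minimal_prime R P \<and> a \<in> P}"

definition z0_ideal :: "('a, 'r) ring_scheme \<Rightarrow> 'a set \<Rightarrow> bool" where
  "z0_ideal R I \<longleftrightarrow> ideal I R \<and> I \<noteq> carrier R \<and> (\<forall>a \<in> I. min_prime_inter R a \<subseteq> I)"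

end

theory Submission
  imports "HOL-Algebra.Ring_Divisibility" Defs
begin

text \<open>If \<open>m\<close> lies outside $rM + (0 :_M r)$, a submodule containing $rM + (0 :_M r)$ and maximal
  with respect to missing \<open>m\<close> is completely irreducible and violates coreducedness. Hence
  $M = rM + (0 :_M r)$, so $rM = r^2M$. As \<open>M\<close> is finitely generated and faithful, Nakayama's
  argument turns this into $r \in r^2R$: the ring \<open>R\<close> is von Neumann regular. In such a ring
  every prime ideal is minimal and $\mathfrak{P}_a = aR$, so every proper ideal, in particular
  $(K :_R N)$, is a $z^\circ$-ideal.\<close>

section \<open>Von Neumann regular rings\<close>

text \<open>Zorn's lemma is applied to the ideals that contain \<open>J\<close> and miss
  \<open>\<one>\<close>. Missing \<open>\<one>\<close> is the form of properness that visibly passes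
  to unions of chains.\<close>

lemma (in ring) proper_ideal_subset_maximalideal:
  assumes "ideal J R" "J \<noteq> carrier R"
  obtains P where "maximalideal P R" "J \<subseteq> P"
proof -
  define A where "A = {I. ideal I R \<and> J \<subseteq> I \<and> \<one> \<notin> I}"
  have "\<exists>P\<in>A. \<forall>X\<in>A. P \<subseteq> X \<longrightarrow> X = P"
  proof (rule subset_Zorn_nonempty)
    show "A \<noteq> {}"
      using assms ideal.one_imp_carrier unfolding A_def by blast
    fix C assume C: "C \<noteq> {}" "subset.chain A C"
    then have "subset.chain {I. ideal I R} C"
      unfolding A_def subset_chain_def by auto
    then have "ideal (\<Union>C) R"
      using chain_Union_is_ideal[of C] C(1) by simp
    then show "\<Union>C \<in> A"
      using C unfolding A_def subset_chain_def by blast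
  qed
  then obtain P where PA: "P \<in> A" and max: "\<forall>X\<in>A. P \<subseteq> X \<longrightarrow> X = P"
    by (rule bexE)
  then have P: "ideal P R" "J \<subseteq> P" "\<one> \<notin> P"
    unfolding A_def by auto
  have "maximalideal P R"
  proof (rule maximalidealI)
    show "ideal P R" by (rule P(1))
    show "carrier R \<noteq> P" using P(3) by auto
    fix I assume "ideal I R" "P \<subseteq> I" "I \<subseteq> carrier R"
    then show "I = P \<or> I = carrier R"
      using bspec[OF max, of I] P(2) ideal.one_imp_carrier[of I R] unfolding A_def by auto
  qed
  then show ?thesis using P(2) that by blast
qed

text \<open>Detects that an element vanishes: for \<open>c\<close> nonzero this ideal misses
  \<open>\<one>\<close>, so it lies in some maximal ideal.\<close>

lemma (in cring) annihilator_ideal: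
  assumes c: "c \<in> carrier R"
  shows "ideal {x \<in> carrier R. x \<otimes> c = \<zero>} R"
proof (rule idealI[OF ring_axioms])
  show "subgroup {x \<in> carrier R. x \<otimes> c = \<zero>} (add_monoid R)"
    using c by (intro add.subgroupI) (auto simp: l_distr l_minus a_inv_def[symmetric])
  fix a x assume a: "a \<in> {x \<in> carrier R. x \<otimes> c = \<zero>}" and x: "x \<in> carrier R"
  then show "x \<otimes> a \<in> {x \<in> carrier R. x \<otimes> c = \<zero>}"
    using c by (simp add: m_assoc)
  then show "a \<otimes> x \<in> {x \<in> carrier R. x \<otimes> c = \<zero>}"
    using a x by (simp add: m_comm)
qed

text \<open>The usual condition \<open>a = a s a\<close>, rewritten by commutativity as divisibility
  of \<open>a\<close> by its own square.\<close>

locale von_neumann_regular_ring = cring +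
  assumes regular: "a \<in> carrier R \<Longrightarrow> \<exists>s\<in>carrier R. a = a \<otimes> a \<otimes> s"
begin

text \<open>Here \<open>a \<otimes> s\<close> is an idempotent generating the same ideal as
  \<open>a\<close>, and \<open>\<one> \<ominus> a \<otimes> s\<close> is the complementary
  idempotent.\<close>

lemma mult_one_minus_eq_zero:
  assumes "a \<in> carrier R" "s \<in> carrier R" "a = a \<otimes> a \<otimes> s"
  shows "a \<otimes> (\<one> \<ominus> a \<otimes> s) = \<zero>"
proof -
  have "a \<otimes> (\<one> \<ominus> a \<otimes> s) = a \<ominus> a \<otimes> a \<otimes> s"
    using assms(1,2) by algebra
  also have "\<dots> = \<zero>"
    using assms by (metis r_right_minus_eq)
  finally show ?thesis .
qed

text \<open>The product of \<open>a\<close> and \<open>\<one> \<ominus> a \<otimes> s\<close> is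
  zero, hence lies in \<open>P\<close>, and primeness selects a factor.\<close>

lemma primeideal_mem_or:
  assumes "primeideal P R" "a \<in> carrier R"
  obtains s where "s \<in> carrier R" "a = a \<otimes> a \<otimes> s" "a \<in> P \<or> \<one> \<ominus> a \<otimes> s \<in> P"
proof -
  interpret P: primeideal P R by fact
  obtain s where s: "s \<in> carrier R" "a = a \<otimes> a \<otimes> s"
    using regular assms(2) by blast
  have "a \<otimes> (\<one> \<ominus> a \<otimes> s) \<in> P"
    using mult_one_minus_eq_zero[OF assms(2) s] by simp
  then have "a \<in> P \<or> \<one> \<ominus> a \<otimes> s \<in> P"
    using P.I_prime[OF assms(2), of "\<one> \<ominus> a \<otimes> s"] assms(2) s(1) by blast
  then show ?thesis using s that by blast
qed

text \<open>The two elements sum to \<open>\<one>\<close> once the first is multiplied by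
  \<open>s\<close>. Together with \<open>primeideal_mem_or\<close>, a prime ideal therefore contains
  exactly one of \<open>a\<close> and \<open>\<one> \<ominus> a \<otimes> s\<close>.\<close>

lemma one_mem_ideal:
  assumes "ideal P R" "a \<in> P" "s \<in> carrier R" "\<one> \<ominus> a \<otimes> s \<in> P"
  shows "\<one> \<in> P"
proof -
  interpret P: ideal P R by fact
  have "a \<in> carrier R" using assms(2) P.Icarr by blast
  then have "\<one> = (\<one> \<ominus> a \<otimes> s) \<oplus> a \<otimes> s"
    using assms(3) by algebra
  then show ?thesis
    using P.a_closed[OF assms(4) P.I_r_closed[OF assms(2,3)]] by simp
qed

text \<open>If \<open>x\<close> were in \<open>P\<close> but not in the smaller prime
  \<open>Q\<close>, the complementary element \<open>\<one> \<ominus> x \<otimes> s\<close> would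
  lie in \<open>Q\<close>, hence in \<open>P\<close> next to \<open>x\<close>, which forces
  \<open>\<one>\<close> into \<open>P\<close>.\<close>

lemma primeideal_imp_minimal_prime:
  assumes "primeideal P R"
  shows "minimal_prime R P"
proof -
  interpret P: primeideal P R by fact
  have "Q = P" if Q: "primeideal Q R" "Q \<subseteq> P" for Q
  proof
    show "P \<subseteq> Q"
    proof
      fix x assume x: "x \<in> P"
      then obtain s where s: "s \<in> carrier R" "x \<in> Q \<or> \<one> \<ominus> x \<otimes> s \<in> Q"
        using primeideal_mem_or[OF Q(1)] P.Icarr by metis
      then show "x \<in> Q"
        using one_mem_ideal[OF P.is_ideal x s(1)] Q(2) P.one_imp_carrier P.I_notcarr by blast
    qed
  qed (rule Q(2))
  then show ?thesis
    using assms unfolding minimal_prime_def by blast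
qed

text \<open>Every \<open>b\<close> in the intersection is a multiple of \<open>a\<close>. Its
  component outside \<open>aR\<close> vanishes because no maximal ideal can contain the annihilator
  of that component.\<close>

lemma min_prime_inter_subset_ideal:
  assumes "ideal I R" "a \<in> I"
  shows "min_prime_inter R a \<subseteq> I"
proof
  interpret I: ideal I R by fact
  fix b assume b: "b \<in> min_prime_inter R a"
  have bc: "b \<in> carrier R" using b by (simp add: min_prime_inter_def)
  have ac: "a \<in> carrier R" using assms(2) I.Icarr by blast
  obtain s where s: "s \<in> carrier R" "a = a \<otimes> a \<otimes> s"
    using regular ac by blast
  \<comment> \<open>The complementary idempotent splits \<open>b\<close> into \<open>c\<close> and
    the multiple \<open>a \<otimes> (s \<otimes> b)\<close> of \<open>a\<close>, so it suffices to
    show that \<open>c\<close> is zero.\<close>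
  define c where "c = b \<otimes> (\<one> \<ominus> a \<otimes> s)"
  have cc: "c \<in> carrier R" using ac bc s by (simp add: c_def)
  have acz: "a \<otimes> c = \<zero>"
  proof -
    have "a \<otimes> c = b \<otimes> (a \<otimes> (\<one> \<ominus> a \<otimes> s))"
      unfolding c_def using ac bc s(1) by algebra
    then show ?thesis using mult_one_minus_eq_zero[OF ac s] bc by simp
  qed
  have "c = \<zero>"
  proof (rule ccontr)
    assume nz: "c \<noteq> \<zero>"
    let ?J = "{x \<in> carrier R. x \<otimes> c = \<zero>}"
    have "\<one> \<notin> ?J" using nz cc by simp
    then have "?J \<noteq> carrier R" using one_closed by blast
    then obtain P where P: "maximalideal P R" "?J \<subseteq> P"
      using proper_ideal_subset_maximalideal[OF annihilator_ideal[OF cc]] by metis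
    have prime: "primeideal P R" using maximalideal_prime P(1) by blast
    interpret P: primeideal P R by fact
    \<comment> \<open>Since \<open>a\<close> annihilates \<open>c\<close>, it lies in
      \<open>P\<close>. As \<open>P\<close> is a minimal prime, it is one of the ideals being
      intersected, so \<open>b\<close> and then \<open>c\<close> lie in \<open>P\<close>.\<close>
    have "a \<in> P" using acz ac P(2) by blast
    then have "b \<in> P"
      using b primeideal_imp_minimal_prime[OF prime] by (auto simp: min_prime_inter_def)
    then have cP: "c \<in> P"
      unfolding c_def using ac s(1) by (intro P.I_r_closed) auto
    \<comment> \<open>Regularity is now applied to \<open>c\<close> itself:
      \<open>\<one> \<ominus> c \<otimes> w\<close> annihilates \<open>c\<close>, so it lies in
      \<open>P\<close> together with \<open>c\<close>.\<close>
    obtain w where w: "w \<in> carrier R" "c = c \<otimes> c \<otimes> w"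
      using regular cc by blast
    have "(\<one> \<ominus> c \<otimes> w) \<otimes> c = \<zero>"
      using mult_one_minus_eq_zero[OF cc w] m_comm[of c "\<one> \<ominus> c \<otimes> w"] cc w(1) by simp
    then have "\<one> \<ominus> c \<otimes> w \<in> P" using P(2) cc w(1) by auto
    then show False
      using one_mem_ideal[OF P.is_ideal cP w(1)] P.one_imp_carrier P.I_notcarr by blast
  qed
  then have "c \<oplus> a \<otimes> (s \<otimes> b) \<in> I"
    using I.I_r_closed[OF assms(2) m_closed[OF s(1) bc]] by simp
  moreover have "c \<oplus> a \<otimes> (s \<otimes> b) = b"
    unfolding c_def using ac bc s(1) by algebra
  ultimately show "b \<in> I" by metis
qed

lemma proper_ideal_imp_z0_ideal:
  assumes "ideal I R" "I \<noteq> carrier R"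
  shows "z0_ideal R I"
  using assms by (simp add: z0_ideal_def min_prime_inter_subset_ideal)

end

section \<open>Finitely generated modules with \<open>rM = r\<^sup>2M\<close>\<close>

definition linear_span ::
    "('a, 'r) ring_scheme \<Rightarrow> ('a, 'b, 'm) module_scheme \<Rightarrow> 'b set \<Rightarrow> 'b set" where
  "linear_span R M X = {(\<Oplus>\<^bsub>M\<^esub>x \<in> X. c x \<odot>\<^bsub>M\<^esub> x) | c. c \<in> X \<rightarrow> carrier R}"

context module
begin

lemma linear_span_closed:
  assumes "X \<subseteq> carrier M" "y \<in> linear_span R M X"
  shows "y \<in> carrier M"
  using assms unfolding linear_span_def by (auto intro!: M.finsum_closed)

text \<open>Isolates the coefficient of one generator, so that an induction on the generating set
  can remove it.\<close>

lemma linear_span_insert: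
  assumes "finite X" "x \<notin> X" "insert x X \<subseteq> carrier M" "v \<in> linear_span R M (insert x X)"
  obtains c y where "c \<in> carrier R" "y \<in> linear_span R M X" "v = c \<odot>\<^bsub>M\<^esub> x \<oplus>\<^bsub>M\<^esub> y"
proof -
  obtain c where c: "c \<in> insert x X \<rightarrow> carrier R"
    "v = (\<Oplus>\<^bsub>M\<^esub>x \<in> insert x X. c x \<odot>\<^bsub>M\<^esub> x)"
    using assms(4) unfolding linear_span_def by blast
  have "v = c x \<odot>\<^bsub>M\<^esub> x \<oplus>\<^bsub>M\<^esub> (\<Oplus>\<^bsub>M\<^esub>x \<in> X. c x \<odot>\<^bsub>M\<^esub> x)"
    unfolding c(2) using assms c(1) by (intro M.finsum_insert) auto
  then show ?thesis
    using that c(1) unfolding linear_span_def by blast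
qed

lemma linear_span_smult:
  assumes "finite X" "X \<subseteq> carrier M" "a \<in> carrier R" "y \<in> linear_span R M X"
  shows "a \<odot>\<^bsub>M\<^esub> y \<in> linear_span R M X"
proof -
  obtain c where c: "c \<in> X \<rightarrow> carrier R" "y = (\<Oplus>\<^bsub>M\<^esub>x \<in> X. c x \<odot>\<^bsub>M\<^esub> x)"
    using assms(4) unfolding linear_span_def by blast
  have "a \<odot>\<^bsub>M\<^esub> y = (\<Oplus>\<^bsub>M\<^esub>x \<in> X. a \<odot>\<^bsub>M\<^esub> (c x \<odot>\<^bsub>M\<^esub> x))"
    unfolding c(2) using assms c(1) by (intro finsum_smult_ldistr) auto
  also have "\<dots> = (\<Oplus>\<^bsub>M\<^esub>x \<in> X. (a \<otimes> c x) \<odot>\<^bsub>M\<^esub> x)"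
    using assms c(1) by (intro M.finsum_cong') (auto simp: smult_assoc1 Pi_iff subset_iff)
  finally show ?thesis
    unfolding linear_span_def using assms(3) c(1) by (auto intro!: exI[of _ "\<lambda>x. a \<otimes> c x"])
qed

lemma linear_span_add:
  assumes "X \<subseteq> carrier M" "y \<in> linear_span R M X" "z \<in> linear_span R M X"
  shows "y \<oplus>\<^bsub>M\<^esub> z \<in> linear_span R M X"
proof -
  obtain c where c: "c \<in> X \<rightarrow> carrier R" "y = (\<Oplus>\<^bsub>M\<^esub>x \<in> X. c x \<odot>\<^bsub>M\<^esub> x)"
    using assms(2) unfolding linear_span_def by blast
  obtain d where d: "d \<in> X \<rightarrow> carrier R" "z = (\<Oplus>\<^bsub>M\<^esub>x \<in> X. d x \<odot>\<^bsub>M\<^esub> x)"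
    using assms(3) unfolding linear_span_def by blast
  have "y \<oplus>\<^bsub>M\<^esub> z = (\<Oplus>\<^bsub>M\<^esub>x \<in> X. c x \<odot>\<^bsub>M\<^esub> x \<oplus>\<^bsub>M\<^esub> d x \<odot>\<^bsub>M\<^esub> x)"
    unfolding c(2) d(2) using assms(1) c(1) d(1)
    by (intro M.finsum_addf[symmetric]) auto
  also have "\<dots> = (\<Oplus>\<^bsub>M\<^esub>x \<in> X. (c x \<oplus> d x) \<odot>\<^bsub>M\<^esub> x)"
    using assms(1) c(1) d(1)
    by (intro M.finsum_cong') (auto simp: smult_l_distr Pi_iff subset_iff)
  finally show ?thesis
    unfolding linear_span_def using c(1) d(1) by (auto intro!: exI[of _ "\<lambda>x. c x \<oplus> d x"])
qed

lemma smult_lcomm: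
  assumes "a \<in> carrier R" "b \<in> carrier R" "x \<in> carrier M"
  shows "a \<odot>\<^bsub>M\<^esub> (b \<odot>\<^bsub>M\<^esub> x) = b \<odot>\<^bsub>M\<^esub> (a \<odot>\<^bsub>M\<^esub> x)"
  using assms by (metis R.m_comm smult_assoc1)

text \<open>The generators of \<open>M\<close> are eliminated one at a time; the
  multiplier \<open>t\<close> stays congruent to \<open>1\<close> modulo \<open>r\<close>.\<close>

lemma nakayama_elimination:
  assumes "finite X" "X \<subseteq> carrier M" and r: "r \<in> carrier R"
    and sq: "\<And>m. m \<in> carrier M \<Longrightarrow> \<exists>m'\<in>carrier M. r \<odot>\<^bsub>M\<^esub> m = r \<odot>\<^bsub>M\<^esub> (r \<odot>\<^bsub>M\<^esub> m')"
    and "q \<in> carrier R"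
    and "\<And>m. m \<in> carrier M \<Longrightarrow>
      \<exists>y\<in>linear_span R M X. (\<one> \<ominus> r \<otimes> q) \<odot>\<^bsub>M\<^esub> (r \<odot>\<^bsub>M\<^esub> m) = r \<odot>\<^bsub>M\<^esub> y"
  shows "\<exists>s\<in>carrier R. \<forall>m\<in>carrier M. (\<one> \<ominus> r \<otimes> s) \<odot>\<^bsub>M\<^esub> (r \<odot>\<^bsub>M\<^esub> m) = \<zero>\<^bsub>M\<^esub>"
  using assms(1,2,5,6)
proof (induction X arbitrary: q)
  case empty
  \<comment> \<open>With no generators left the span is zero, so the current \<open>q\<close>
    already serves as \<open>s\<close>.\<close>
  have "(\<one> \<ominus> r \<otimes> q) \<odot>\<^bsub>M\<^esub> (r \<odot>\<^bsub>M\<^esub> m) = \<zero>\<^bsub>M\<^esub>" if "m \<in> carrier M" for m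
    using empty.prems(3)[OF that] r by (auto simp: linear_span_def)
  then show ?case
    using empty.prems(2) by blast
next
  case (insert x X)
  define t where "t = \<one> \<ominus> r \<otimes> q"
  have q: "q \<in> carrier R" by (rule insert.prems(2))
  have t: "t \<in> carrier R" using r q by (simp add: t_def)
  have x: "x \<in> carrier M" and X: "X \<subseteq> carrier M" using insert.prems(1) by auto
  have step: "\<exists>c\<in>carrier R. \<exists>y\<in>linear_span R M X.
      t \<odot>\<^bsub>M\<^esub> (r \<odot>\<^bsub>M\<^esub> m) = r \<odot>\<^bsub>M\<^esub> (c \<odot>\<^bsub>M\<^esub> x \<oplus>\<^bsub>M\<^esub> y)" if "m \<in> carrier M" for m
    using insert.prems(3)[OF that, folded t_def] linear_span_insert[OF insert.hyps insert.prems(1)]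
    by metis
  \<comment> \<open>Passing from \<open>x\<close> to \<open>m'\<close> gains a factor
    \<open>r\<close>, so that the coefficient of \<open>x\<close> in the resulting relation is a
    multiple of \<open>r\<close>.\<close>
  obtain m' where m': "m' \<in> carrier M" "r \<odot>\<^bsub>M\<^esub> x = r \<odot>\<^bsub>M\<^esub> (r \<odot>\<^bsub>M\<^esub> m')"
    using sq x by blast
  obtain c y where c: "c \<in> carrier R" and y: "y \<in> linear_span R M X"
    and cy: "t \<odot>\<^bsub>M\<^esub> (r \<odot>\<^bsub>M\<^esub> m') = r \<odot>\<^bsub>M\<^esub> (c \<odot>\<^bsub>M\<^esub> x \<oplus>\<^bsub>M\<^esub> y)"
    using step[OF m'(1)] by blast
  have ym: "y \<in> carrier M" using linear_span_closed[OF X y] .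
  \<comment> \<open>Moving the term in \<open>x\<close> to the left leaves \<open>p\<close> as its
    coefficient. Like \<open>t\<close>, it is congruent to 1 modulo \<open>r\<close>.\<close>
  define p where "p = t \<ominus> r \<otimes> c"
  have p: "p \<in> carrier R" using t r c by (simp add: p_def)
  have px: "p \<odot>\<^bsub>M\<^esub> (r \<odot>\<^bsub>M\<^esub> x) = r \<odot>\<^bsub>M\<^esub> (r \<odot>\<^bsub>M\<^esub> y)"
  proof -
    have tp: "t = (r \<otimes> c) \<oplus> p" unfolding p_def using t r c by algebra
    have "(r \<otimes> c) \<odot>\<^bsub>M\<^esub> (r \<odot>\<^bsub>M\<^esub> x) \<oplus>\<^bsub>M\<^esub> p \<odot>\<^bsub>M\<^esub> (r \<odot>\<^bsub>M\<^esub> x) = t \<odot>\<^bsub>M\<^esub> (r \<odot>\<^bsub>M\<^esub> x)"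
      unfolding tp using p r c x by (simp add: smult_l_distr)
    also have "\<dots> = r \<odot>\<^bsub>M\<^esub> (t \<odot>\<^bsub>M\<^esub> (r \<odot>\<^bsub>M\<^esub> m'))"
      unfolding m'(2) using t r m'(1) by (intro smult_lcomm) auto
    also have "\<dots> = r \<odot>\<^bsub>M\<^esub> (r \<odot>\<^bsub>M\<^esub> (c \<odot>\<^bsub>M\<^esub> x)) \<oplus>\<^bsub>M\<^esub> r \<odot>\<^bsub>M\<^esub> (r \<odot>\<^bsub>M\<^esub> y)"
      unfolding cy using r c x ym by (simp add: smult_r_distr)
    also have "r \<odot>\<^bsub>M\<^esub> (r \<odot>\<^bsub>M\<^esub> (c \<odot>\<^bsub>M\<^esub> x)) = (r \<otimes> c) \<odot>\<^bsub>M\<^esub> (r \<odot>\<^bsub>M\<^esub> x)"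
      using r c x smult_lcomm[of c r x] by (simp add: smult_assoc1)
    finally show ?thesis
      using r c p x ym by simp
  qed
  \<comment> \<open>Read off by expanding \<open>p \<otimes> t\<close>, the product of
    \<open>\<one> \<ominus> r \<otimes> (q \<oplus> c)\<close> and
    \<open>\<one> \<ominus> r \<otimes> q\<close>.\<close>
  define q' where "q' = q \<oplus> (q \<oplus> c) \<ominus> r \<otimes> (q \<otimes> (q \<oplus> c))"
  have q': "q' \<in> carrier R" using q c r by (simp add: q'_def)
  have pt: "\<one> \<ominus> r \<otimes> q' = p \<otimes> t"
    unfolding q'_def p_def t_def using q c r by algebra
  show ?case
  proof (rule insert.IH[OF X q'])
    fix m assume m: "m \<in> carrier M"
    obtain d z where d: "d \<in> carrier R" and z: "z \<in> linear_span R M X"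
      and dz: "t \<odot>\<^bsub>M\<^esub> (r \<odot>\<^bsub>M\<^esub> m) = r \<odot>\<^bsub>M\<^esub> (d \<odot>\<^bsub>M\<^esub> x \<oplus>\<^bsub>M\<^esub> z)"
      using step[OF m] by blast
    have zm: "z \<in> carrier M" using linear_span_closed[OF X z] .
    have "(\<one> \<ominus> r \<otimes> q') \<odot>\<^bsub>M\<^esub> (r \<odot>\<^bsub>M\<^esub> m) = p \<odot>\<^bsub>M\<^esub> (r \<odot>\<^bsub>M\<^esub> (d \<odot>\<^bsub>M\<^esub> x \<oplus>\<^bsub>M\<^esub> z))"
      unfolding pt dz[symmetric] using p t r m by (simp add: smult_assoc1)
    also have "\<dots> = p \<odot>\<^bsub>M\<^esub> (r \<odot>\<^bsub>M\<^esub> (d \<odot>\<^bsub>M\<^esub> x)) \<oplus>\<^bsub>M\<^esub> p \<odot>\<^bsub>M\<^esub> (r \<odot>\<^bsub>M\<^esub> z)"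
      using p r d x zm by (simp add: smult_r_distr)
    \<comment> \<open>The factor \<open>p\<close> is brought next to \<open>x\<close>, where
      \<open>px\<close> trades \<open>x\<close> for \<open>y\<close>. Only a combination of
      \<open>X\<close> then remains behind the outer \<open>r\<close>.\<close>
    also have "p \<odot>\<^bsub>M\<^esub> (r \<odot>\<^bsub>M\<^esub> (d \<odot>\<^bsub>M\<^esub> x)) = d \<odot>\<^bsub>M\<^esub> (p \<odot>\<^bsub>M\<^esub> (r \<odot>\<^bsub>M\<^esub> x))"
      using p r d x smult_lcomm[of d r x] smult_lcomm[of d p "r \<odot>\<^bsub>M\<^esub> x"] by simp
    also have "\<dots> = r \<odot>\<^bsub>M\<^esub> (d \<odot>\<^bsub>M\<^esub> (r \<odot>\<^bsub>M\<^esub> y))"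
      unfolding px using d r ym by (intro smult_lcomm) auto
    also have "p \<odot>\<^bsub>M\<^esub> (r \<odot>\<^bsub>M\<^esub> z) = r \<odot>\<^bsub>M\<^esub> (p \<odot>\<^bsub>M\<^esub> z)"
      using p r zm by (intro smult_lcomm) auto
    also have "r \<odot>\<^bsub>M\<^esub> (d \<odot>\<^bsub>M\<^esub> (r \<odot>\<^bsub>M\<^esub> y)) \<oplus>\<^bsub>M\<^esub> r \<odot>\<^bsub>M\<^esub> (p \<odot>\<^bsub>M\<^esub> z) =
        r \<odot>\<^bsub>M\<^esub> (d \<odot>\<^bsub>M\<^esub> (r \<odot>\<^bsub>M\<^esub> y) \<oplus>\<^bsub>M\<^esub> p \<odot>\<^bsub>M\<^esub> z)"
      using p r d ym zm by (simp add: smult_r_distr)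
    finally have eq: "(\<one> \<ominus> r \<otimes> q') \<odot>\<^bsub>M\<^esub> (r \<odot>\<^bsub>M\<^esub> m) =
        r \<odot>\<^bsub>M\<^esub> (d \<odot>\<^bsub>M\<^esub> (r \<odot>\<^bsub>M\<^esub> y) \<oplus>\<^bsub>M\<^esub> p \<odot>\<^bsub>M\<^esub> z)" .
    have "d \<odot>\<^bsub>M\<^esub> (r \<odot>\<^bsub>M\<^esub> y) \<oplus>\<^bsub>M\<^esub> p \<odot>\<^bsub>M\<^esub> z \<in> linear_span R M X"
      by (intro linear_span_add linear_span_smult insert.hyps(1) X d r p y z)
    with eq show "\<exists>w\<in>linear_span R M X. (\<one> \<ominus> r \<otimes> q') \<odot>\<^bsub>M\<^esub> (r \<odot>\<^bsub>M\<^esub> m) = r \<odot>\<^bsub>M\<^esub> w"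
      by (rule bexI)
  qed
qed

text \<open>Elimination starts from a full generating set with \<open>q\<close> zero, that is, with
  multiplier 1. It ends with \<open>(\<one> \<ominus> r \<otimes> s) \<otimes> r\<close>
  annihilating \<open>M\<close>, which faithfulness turns into an equation in
  \<open>R\<close>.\<close>

lemma faithful_fg_square_dvd:
  assumes "finitely_generated_module R M" "faithful_module R M" and r: "r \<in> carrier R"
    and sq: "\<And>m. m \<in> carrier M \<Longrightarrow> \<exists>m'\<in>carrier M. r \<odot>\<^bsub>M\<^esub> m = r \<odot>\<^bsub>M\<^esub> (r \<odot>\<^bsub>M\<^esub> m')"
  shows "\<exists>s\<in>carrier R. r = r \<otimes> r \<otimes> s"
proof -
  obtain X where X: "finite X" "X \<subseteq> carrier M" "carrier M = linear_span R M X"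
    using assms(1) unfolding finitely_generated_module_def linear_span_def by blast
  have "\<exists>s\<in>carrier R. \<forall>m\<in>carrier M. (\<one> \<ominus> r \<otimes> s) \<odot>\<^bsub>M\<^esub> (r \<odot>\<^bsub>M\<^esub> m) = \<zero>\<^bsub>M\<^esub>"
  proof (rule nakayama_elimination[OF X(1,2) r sq R.zero_closed])
    fix m assume m: "m \<in> carrier M"
    have "\<one> \<ominus> r \<otimes> \<zero> = \<one>" using r by algebra
    then have "(\<one> \<ominus> r \<otimes> \<zero>) \<odot>\<^bsub>M\<^esub> (r \<odot>\<^bsub>M\<^esub> m) = r \<odot>\<^bsub>M\<^esub> m"
      using m r by simp
    moreover have "m \<in> linear_span R M X" using m X(3) by blast
    ultimately show "\<exists>y\<in>linear_span R M X. (\<one> \<ominus> r \<otimes> \<zero>) \<odot>\<^bsub>M\<^esub> (r \<odot>\<^bsub>M\<^esub> m) = r \<odot>\<^bsub>M\<^esub> y"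
      by (rule bexI)
  qed
  then obtain s where s: "s \<in> carrier R"
    "\<And>m. m \<in> carrier M \<Longrightarrow> (\<one> \<ominus> r \<otimes> s) \<odot>\<^bsub>M\<^esub> (r \<odot>\<^bsub>M\<^esub> m) = \<zero>\<^bsub>M\<^esub>"
    by blast
  have "(\<one> \<ominus> r \<otimes> s) \<otimes> r \<in> ann_ring R M (carrier M)"
    using r s by (simp add: ann_ring_def colon_ring_def smult_assoc1)
  then have "(\<one> \<ominus> r \<otimes> s) \<otimes> r = \<zero>"
    using assms(2) by (simp add: faithful_module_def)
  moreover have "r = (\<one> \<ominus> r \<otimes> s) \<otimes> r \<oplus> r \<otimes> r \<otimes> s"
    using r s(1) by algebra
  ultimately have "r = r \<otimes> r \<otimes> s"
    using r s(1) by simp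
  then show ?thesis using s(1) by blast
qed

section \<open>Coreduced modules\<close>

lemma chain_Union_is_submodule:
  assumes "C \<noteq> {}" "subset.chain {N. submodule N R M} C"
  shows "submodule (\<Union>C) R M"
proof (rule submoduleI)
  have sub: "submodule N R M" if "N \<in> C" for N
    using assms(2) that unfolding subset_chain_def by blast
  show "\<Union>C \<subseteq> carrier M"
    using submoduleE(1) sub by blast
  obtain N where N: "N \<in> C" using assms(1) by blast
  then show "\<zero>\<^bsub>M\<^esub> \<in> \<Union>C"
    using subgroup.one_closed[OF submodule.axioms(1)[OF sub[OF N]]] by auto
  show "\<ominus>\<^bsub>M\<^esub> a \<in> \<Union>C" if "a \<in> \<Union>C" for a
    using submoduleE(3) sub that by blast
  show "a \<odot>\<^bsub>M\<^esub> x \<in> \<Union>C" if "a \<in> carrier R" "x \<in> \<Union>C" for a x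
    using submoduleE(4) sub that by blast
  show "a \<oplus>\<^bsub>M\<^esub> b \<in> \<Union>C" if ab: "a \<in> \<Union>C" "b \<in> \<Union>C" for a b
  proof -
    \<comment> \<open>Comparability in the chain places both summands in one member.\<close>
    obtain N where "N \<in> C" "a \<in> N" "b \<in> N"
      using ab assms(2) unfolding subset_chain_def by blast
    then show ?thesis using submoduleE(5) sub by blast
  qed
qed

text \<open>Among the submodules containing \<open>N\<close> and missing \<open>m\<close>, take a
  maximal one. Every strictly larger submodule contains \<open>m\<close>, and so does any
  intersection of such submodules.\<close>

lemma completely_irreducible_avoiding:
  assumes "submodule N R M" "m \<in> carrier M" "m \<notin> N"
  obtains L where "completely_irreducible R M L" "N \<subseteq> L" "m \<notin> L"
proof -
  define A where "A = {L. submodule L R M \<and> N \<subseteq> L \<and> m \<notin> L}"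
  have "\<exists>L\<in>A. \<forall>X\<in>A. L \<subseteq> X \<longrightarrow> X = L"
  proof (rule subset_Zorn_nonempty)
    show "A \<noteq> {}" using assms unfolding A_def by blast
    fix C assume C: "C \<noteq> {}" "subset.chain A C"
    then have "subset.chain {N. submodule N R M} C"
      unfolding A_def subset_chain_def by auto
    then have "submodule (\<Union>C) R M"
      by (rule chain_Union_is_submodule[OF C(1)])
    moreover have "\<forall>L\<in>C. N \<subseteq> L \<and> m \<notin> L"
      using C(2) unfolding A_def subset_chain_def by auto
    ultimately show "\<Union>C \<in> A"
      using C(1) unfolding A_def by blast
  qed
  then obtain L where LA: "L \<in> A" and max: "\<forall>X\<in>A. L \<subseteq> X \<longrightarrow> X = L"
    by (rule bexE)
  then have L: "submodule L R M" "N \<subseteq> L" "m \<notin> L"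
    unfolding A_def by auto
  have "L \<in> F" if F: "\<forall>N\<in>F. submodule N R M" "L = carrier M \<inter> \<Inter>F" for F
  proof (rule ccontr)
    assume "L \<notin> F"
    \<comment> \<open>For empty \<open>F\<close> this is vacuous; the intersection is then the whole
      carrier, which contains \<open>m\<close> too.\<close>
    have "m \<in> X" if X: "X \<in> F" for X
    proof -
      have "L \<subseteq> X" "X \<noteq> L" "submodule X R M" using X F \<open>L \<notin> F\<close> by auto
      then show ?thesis using bspec[OF max, of X] L(2) unfolding A_def by auto
    qed
    then show False using F(2) L(3) assms(2) by blast
  qed
  then have "completely_irreducible R M L"
    using L assms(2) unfolding completely_irreducible_def by blast
  then show ?thesis using that L by blast
qed

lemma coreduced_square:
  assumes "coreduced_module R M" and r: "r \<in> carrier R" and m: "m \<in> carrier M"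
  shows "\<exists>m'\<in>carrier M. r \<odot>\<^bsub>M\<^esub> m = r \<odot>\<^bsub>M\<^esub> (r \<odot>\<^bsub>M\<^esub> m')"
proof (rule ccontr)
  assume no: "\<not> ?thesis"
  \<comment> \<open>This is $rM + (0 :_M r)$.\<close>
  define N where
    "N = {x \<in> carrier M. \<exists>m'\<in>carrier M. r \<odot>\<^bsub>M\<^esub> x = r \<odot>\<^bsub>M\<^esub> (r \<odot>\<^bsub>M\<^esub> m')}"
  have N: "submodule N R M"
  proof (rule submoduleI)
    show "N \<subseteq> carrier M" by (auto simp: N_def)
    show "\<zero>\<^bsub>M\<^esub> \<in> N" using r by (auto simp: N_def intro!: bexI[of _ "\<zero>\<^bsub>M\<^esub>"])
  next
    fix x assume "x \<in> N"
    then obtain u where "x \<in> carrier M" "u \<in> carrier M" "r \<odot>\<^bsub>M\<^esub> x = r \<odot>\<^bsub>M\<^esub> (r \<odot>\<^bsub>M\<^esub> u)"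
      by (auto simp: N_def)
    then show "\<ominus>\<^bsub>M\<^esub> x \<in> N"
      using r by (auto simp: N_def smult_r_minus intro!: bexI[of _ "\<ominus>\<^bsub>M\<^esub> u"])
  next
    fix x y assume "x \<in> N" "y \<in> N"
    then obtain u v where "x \<in> carrier M" "u \<in> carrier M" "r \<odot>\<^bsub>M\<^esub> x = r \<odot>\<^bsub>M\<^esub> (r \<odot>\<^bsub>M\<^esub> u)"
      "y \<in> carrier M" "v \<in> carrier M" "r \<odot>\<^bsub>M\<^esub> y = r \<odot>\<^bsub>M\<^esub> (r \<odot>\<^bsub>M\<^esub> v)"
      by (auto simp: N_def)
    then show "x \<oplus>\<^bsub>M\<^esub> y \<in> N"
      using r by (auto simp: N_def smult_r_distr intro!: bexI[of _ "u \<oplus>\<^bsub>M\<^esub> v"])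
  next
    fix a x assume a: "a \<in> carrier R" and "x \<in> N"
    then obtain u where u: "x \<in> carrier M" "u \<in> carrier M" "r \<odot>\<^bsub>M\<^esub> x = r \<odot>\<^bsub>M\<^esub> (r \<odot>\<^bsub>M\<^esub> u)"
      by (auto simp: N_def)
    have "r \<odot>\<^bsub>M\<^esub> (a \<odot>\<^bsub>M\<^esub> x) = a \<odot>\<^bsub>M\<^esub> (r \<odot>\<^bsub>M\<^esub> (r \<odot>\<^bsub>M\<^esub> u))"
      using a r u smult_lcomm[of r a x] by simp
    also have "\<dots> = r \<odot>\<^bsub>M\<^esub> (r \<odot>\<^bsub>M\<^esub> (a \<odot>\<^bsub>M\<^esub> u))"
      using a r u smult_lcomm[of a r "r \<odot>\<^bsub>M\<^esub> u"] smult_lcomm[of a r u] by simp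
    finally show "a \<odot>\<^bsub>M\<^esub> x \<in> N"
      using a u by (auto simp: N_def)
  qed
  \<comment> \<open>The condition defining \<open>N\<close> is exactly the claim being refuted for
    \<open>m\<close>.\<close>
  have "m \<notin> N" using no by (auto simp: N_def)
  then obtain L where L: "completely_irreducible R M L" "N \<subseteq> L" "m \<notin> L"
    using completely_irreducible_avoiding[OF N m] by metis
  have Lsub: "submodule L R M" using L(1) by (simp add: completely_irreducible_def)
  \<comment> \<open>Every multiple by \<open>r\<close> lies in \<open>N\<close>, with
    \<open>x\<close> itself as witness; this supplies the premise of coreducedness.\<close>
  have "r \<odot>\<^bsub>M\<^esub> x \<in> L" if "x \<in> carrier M" for x
    using that r L(2) by (auto simp: N_def)
  then have "colon_module M L r = carrier M"
    by (auto simp: colon_module_def)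
  then have sum: "L <+>\<^bsub>M\<^esub> colon_module M {\<zero>\<^bsub>M\<^esub>} r = carrier M"
    using assms(1) r L(1) by (simp add: coreduced_module_def)
  \<comment> \<open>The witness is zero. The second summand is thus absorbed by \<open>L\<close>,
    which would make \<open>L\<close> the whole module.\<close>
  have "colon_module M {\<zero>\<^bsub>M\<^esub>} r \<subseteq> N"
    using r by (auto simp: colon_module_def N_def intro!: bexI[of _ "\<zero>\<^bsub>M\<^esub>"])
  then have "L <+>\<^bsub>M\<^esub> colon_module M {\<zero>\<^bsub>M\<^esub>} r \<subseteq> L"
    using L(2) submoduleE(5)[OF Lsub] by (auto simp: set_add_def')
  then show False using sum m L(3) by blast
qed

lemma coreduced_faithful_fg_imp_regular:
  assumes "coreduced_module R M" "faithful_module R M" "finitely_generated_module R M"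
  shows "von_neumann_regular_ring R"
proof
  show "\<exists>s\<in>carrier R. a = a \<otimes> a \<otimes> s" if "a \<in> carrier R" for a
    using faithful_fg_square_dvd[OF assms(3,2) that] coreduced_square[OF assms(1) that] by blast
qed

section \<open>Residuals as ideals, and the conclusion\<close>

lemma colon_ring_ideal:
  assumes K: "submodule K R M" and N: "N \<subseteq> carrier M"
  shows "ideal (colon_ring R M K N) R"
proof (rule idealI[OF R.ring_axioms])
  have K0: "\<zero>\<^bsub>M\<^esub> \<in> K"
    using subgroup.one_closed[OF submodule.axioms(1)[OF K]] by simp
  have NM: "x \<in> N \<Longrightarrow> x \<in> carrier M" for x using N by blast
  show "subgroup (colon_ring R M K N) (add_monoid R)"
  proof (rule R.add.subgroupI)
    have "\<zero> \<in> colon_ring R M K N" using K0 NM by (simp add: colon_ring_def)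
    then show "colon_ring R M K N \<noteq> {}" by blast
  qed (use submoduleE(3,5)[OF K] NM in
      \<open>auto simp: colon_ring_def smult_l_distr smult_l_minus a_inv_def[symmetric]\<close>)
  fix a x assume a: "a \<in> colon_ring R M K N" and x: "x \<in> carrier R"
  show "x \<otimes> a \<in> colon_ring R M K N"
    using a x submoduleE(4)[OF K] NM by (simp add: colon_ring_def smult_assoc1)
  then show "a \<otimes> x \<in> colon_ring R M K N"
    using a x R.m_comm[of a x] by (simp add: colon_ring_def)
qed

end

theorem theorem4p8:
  fixes R :: "('a, 'r) ring_scheme" and M :: "('a, 'b, 'm) module_scheme"
  assumes "module R M"
    and "coreduced_module R M"
    and "faithful_module R M"
    and "finitely_generated_module R M"
    and "comultiplication_module R M"
  shows "(\<forall>N. dqz0_submodule R M N \<longrightarrow>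
            (\<forall>K. submodule K R M \<and> colon_ring R M K N \<noteq> carrier R \<longrightarrow>
                 z0_ideal R (colon_ring R M K N)))
       \<and> (max_second_sum R M (carrier M) = carrier M \<longrightarrow>
            (\<forall>K. submodule K R M \<and> colon_ring R M K (carrier M) \<noteq> carrier R \<longrightarrow>
                 z0_ideal R (colon_ring R M K (carrier M))))"
proof -
  interpret module R M by fact
  interpret von_neumann_regular_ring R
    using coreduced_faithful_fg_imp_regular assms by blast
  \<comment> \<open>Allowing any subset \<open>N\<close> of the carrier covers both halves at once;
    the second takes \<open>N\<close> to be \<open>carrier M\<close>.\<close>
  have "z0_ideal R (colon_ring R M K N)"
    if "submodule K R M" "N \<subseteq> carrier M" "colon_ring R M K N \<noteq> carrier R" for K N
    using that by (intro proper_ideal_imp_z0_ideal colon_ring_ideal)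
  then show ?thesis
    using submoduleE(1) unfolding dqz0_submodule_def by blast
qed

end
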